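(* Let $p$ be a prime of the form $p = 3n+1$ for some integer $n$, let $\alpha$ be an element of order $3$ in $\mathbb{Z}_p^*$, and let $\mathcal{W} = \mathbb{Z}_p^2 \rtimes \mathcal{S}$ be the group constructed from $p$ and $\alpha$ as described in the context. Then the commuting graph of $\mathcal{W}$ has diameter $6$.
   Context: Set $\beta := \alpha+1 \in \mathbb{Z}_p$. In $\mathrm{GL}(2,p)$ put $$J := \begin{bmatrix}0&1\\-1&0\end{bmatrix},\quad K := \begin{bmatrix}\alpha&\beta\\ \beta&-\alpha\end{bmatrix},\quad L := \begin{bmatrix}\beta&-\alpha\\-\alpha&-\beta\end{bmatrix},\quad Z := \begin{bmatrix}-\beta&\alpha\\0&1\end{bmatrix},$$ and $\mathcal{S} := \langle J,K,L,Z\rangle \leq \mathrm{GL}(2,p)$ (a group isomorphic to $\mathrm{SL}(2,3)$). The group $\mathcal{W} = \mathbb{Z}_p^2\rtimes\mathcal{S} \leq \mathrm{AGL}(2,p)$ consists of the pairs $(\mathbf{x},X)$ with $\mathbf{x}\in\mathbb{Z}_p^2$ (row vectors) and $X\in\mathcal{S}$, with product $(\mathbf{x},X)(\mathbf{y},Y) = (\mathbf{x}+\mathbf{y}X^{-1}, XY)$. The commuting graph of a group $G$ is the simple undirected graph whose vertices are the non-central elements of $G$, with two distinct vertices $x,y$ adjacent if and only if $xy=yx$. The distance between two vertices is the length of a shortest path between them ($\infty$ if there is none), and the diameter is the maximum distance between two vertices. *)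

theory Defs
  imports
    "HOL-Analysis.Determinants"
    "HOL-Algebra.Generated_Groups"
    "HOL-Algebra.Multiplicative_Group"
    "HOL-Algebra.Algebraic_Closure_Type"
    "Berlekamp_Zassenhaus.Finite_Field"
    "Graph_Theory.Graph_Theory"
begin

definition group_center :: "('a, 'b) monoid_scheme \<Rightarrow> 'a set" where
  "group_center G = {z \<in> carrier G. \<forall>g \<in> carrier G. z \<otimes>\<^bsub>G\<^esub> g = g \<otimes>\<^bsub>G\<^esub> z}"

text \<open>As usual in \<^theory>\<open>Graph_Theory.Graph_Theory\<close>, a simple undirected graph is a symmetric
  loop-free digraph without parallel arcs; here every edge is represented by its two
  orientations.\<close>

definition commuting_graph :: "('a, 'b) monoid_scheme \<Rightarrow> 'a pair_pre_digraph" where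
  "commuting_graph G =
     \<lparr> pverts = carrier G - group_center G,
       parcs = {(x, y). x \<in> carrier G - group_center G \<and> y \<in> carrier G - group_center G \<and>
                        x \<noteq> y \<and> x \<otimes>\<^bsub>G\<^esub> y = y \<otimes>\<^bsub>G\<^esub> x} \<rparr>"

lemma commuting_graph_bidirected: "pair_bidirected_digraph (commuting_graph G)"
  by unfold_locales (auto simp: commuting_graph_def arcs_ends_conv symmetric_def intro!: symI)

text \<open>With the constant weight \<open>1\<close>, the cost of a walk is its length, so that
  \<^const>\<open>wf_digraph.\<mu>\<close> is the length of a shortest path, and \<open>\<infinity>\<close> if there is none.\<close>

definition graph_distance :: "'a pair_pre_digraph \<Rightarrow> 'a \<Rightarrow> 'a \<Rightarrow> ereal" where
  "graph_distance G u v = wf_digraph.\<mu> (with_proj G) (\<lambda>_. 1) u v"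

definition graph_diameter :: "'a pair_pre_digraph \<Rightarrow> ereal" where
  "graph_diameter G = (SUP (u, v) \<in> pverts G \<times> pverts G. graph_distance G u v)"

definition GL :: "('a::field ^ 'n ^ 'n) monoid" where
  "GL = \<lparr> carrier = {A. invertible A}, monoid.mult = (**), one = mat 1 \<rparr>"

definition matJ :: "'a::field ^ 2 ^ 2" where
  "matJ = vector [vector [0, 1], vector [-1, 0]]"

definition matK :: "'a::field \<Rightarrow> 'a ^ 2 ^ 2" where
  "matK \<alpha> = (let \<beta> = \<alpha> + 1 in vector [vector [\<alpha>, \<beta>], vector [\<beta>, -\<alpha>]])"

definition matL :: "'a::field \<Rightarrow> 'a ^ 2 ^ 2" where
  "matL \<alpha> = (let \<beta> = \<alpha> + 1 in vector [vector [\<beta>, -\<alpha>], vector [-\<alpha>, -\<beta>]])"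

definition matZ :: "'a::field \<Rightarrow> 'a ^ 2 ^ 2" where
  "matZ \<alpha> = (let \<beta> = \<alpha> + 1 in vector [vector [-\<beta>, \<alpha>], vector [0, 1]])"

definition groupS :: "'a::field \<Rightarrow> ('a ^ 2 ^ 2) set" where
  "groupS \<alpha> = generate GL {matJ, matK \<alpha>, matL \<alpha>, matZ \<alpha>}"

text \<open>Vectors are row vectors, hence the product \<^const>\<open>vector_matrix_mult\<close> with the matrix on
  the right.\<close>

definition groupW :: "'a::field \<Rightarrow> (('a ^ 2) \<times> ('a ^ 2 ^ 2)) monoid" where
  "groupW \<alpha> =
     \<lparr> carrier = UNIV \<times> groupS \<alpha>,
       monoid.mult = (\<lambda>(x, A) (y, B). (x + y v* (inv\<^bsub>GL\<^esub> A), A ** B)),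
       one = (0, mat 1) \<rparr>"

end

(*
  An element (y, Y) of W whose linear part Y fixes a nonzero row vector commutes with a translation.
  Otherwise (y, Y) is the conjugate of (0, Y) by a translation a, so it commutes with the conjugate
  of (0, -1) by a, which commutes with the conjugate of (0, Z) by a, which commutes with the
  translations by vectors fixed by Z. Hence every vertex is within distance 3 of one fixed translation.

  For the lower bound take (0, J) and its conjugate by the translation a = (1, 1). A walk of length 2
  from (0, J), resp. from its conjugate, stays inside the complement S, resp. the conjugate of S by a.
  If an element with linear part A of the first complement commutes with one with linear part B of
  the second, then (1 - B^-1)(1 - A^-1) kills a. Then A and B have order 3 and generate the same
  subgroup; as B - 1 and (B - 1)^2 have the same kernel, a would be fixed by B, but (1, 1) lies on
  none of the four lines of fixed vectors.
*)

theory Submission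
  imports Defs
begin

section \<open>Walks and distances in a commuting graph as powers of a reflexive relation\<close>

definition commuting_rel :: "('a, 'b) monoid_scheme \<Rightarrow> ('a \<times> 'a) set" where
  "commuting_rel G = {(x, y). x \<in> carrier G - group_center G \<and> y \<in> carrier G - group_center G \<and>
                        x \<otimes>\<^bsub>G\<^esub> y = y \<otimes>\<^bsub>G\<^esub> x}"

lemma pverts_commuting_graph: "pverts (commuting_graph G) = carrier G - group_center G"
  by (simp add: commuting_graph_def)

lemma parcs_commuting_graph: "parcs (commuting_graph G) = {(x, y) \<in> commuting_rel G. x \<noteq> y}"
  by (auto simp: commuting_graph_def commuting_rel_def)

lemma wf_commuting_graph: "wf_digraph (commuting_graph G)"
  by unfold_locales (auto simp: commuting_graph_def)

lemma awalk_imp_relpow: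
  assumes "pre_digraph.awalk (commuting_graph G) u w v"
  shows "(u, v) \<in> commuting_rel G ^^ length w"
  using assms
proof (induction w arbitrary: u)
  case Nil
  then show ?case by (simp add: pre_digraph.awalk_def pre_digraph.cas.simps)
next
  case (Cons e w)
  interpret wf_digraph "commuting_graph G" by (rule wf_commuting_graph)
  from Cons.prems have "e \<in> parcs (commuting_graph G)" "fst e = u" "awalk (snd e) w v"
    by (simp_all add: awalk_Cons_iff)
  then have "(u, snd e) \<in> commuting_rel G" "(snd e, v) \<in> commuting_rel G ^^ length w"
    using Cons.IH by (auto simp: commuting_rel_def commuting_graph_def)
  then show ?case by (simp add: relpow_Suc_I2 del: relpow.simps)
qed

lemma relpow_imp_awalk:
  assumes "(u, v) \<in> commuting_rel G ^^ n" "u \<in> pverts (commuting_graph G)"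
  shows "\<exists>w. pre_digraph.awalk (commuting_graph G) u w v \<and> length w \<le> n"
  using assms
proof (induction n arbitrary: u)
  case 0
  interpret wf_digraph "commuting_graph G" by (rule wf_commuting_graph)
  from 0 show ?case by (auto simp: awalk_Nil_iff)
next
  case (Suc n)
  interpret wf_digraph "commuting_graph G" by (rule wf_commuting_graph)
  from Suc.prems obtain x where x: "(u, x) \<in> commuting_rel G" "(x, v) \<in> commuting_rel G ^^ n"
    by (metis relpow_Suc_D2)
  then have "x \<in> pverts (commuting_graph G)" by (auto simp: commuting_rel_def commuting_graph_def)
  with Suc.IH x(2) obtain w where w: "awalk x w v" "length w \<le> n" by blast
  \<comment> \<open>The relation has loops but the graph has none: a step that stays at
    \<open>u\<close> is dropped, so the walk may be shorter than \<open>Suc n\<close>.\<close>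
  show ?case
  proof (cases "x = u")
    case True
    with w show ?thesis by auto
  next
    case False
    with x(1) w(1) have "awalk u ((u, x) # w) v"
      by (simp add: awalk_Cons_iff parcs_commuting_graph)
    with w(2) show ?thesis by (metis Suc_le_mono length_Cons)
  qed
qed

text \<open>Every vertex commutes with itself, so a short walk can be padded by waiting at its
  start; hence the n-th power expresses distance at most n.\<close>

lemma commuting_rel_relpow_mono:
  assumes "(u, v) \<in> commuting_rel G ^^ m" "m \<le> n" "u \<in> carrier G - group_center G"
  shows "(u, v) \<in> commuting_rel G ^^ n"
proof -
  have "(u, u) \<in> commuting_rel G ^^ k" for k
    using assms(3) by (induction k) (auto simp: commuting_rel_def intro: relpow_Suc_I)
  then have "(u, v) \<in> commuting_rel G ^^ (n - m + m)"
    using assms(1) unfolding relpow_add by blast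
  with assms(2) show ?thesis by simp
qed

lemma commuting_rel_relpow_sym:
  "(u, v) \<in> commuting_rel G ^^ n \<Longrightarrow> (v, u) \<in> commuting_rel G ^^ n"
proof (induction n arbitrary: v)
  case (Suc n)
  then obtain x where "(u, x) \<in> commuting_rel G ^^ n" "(x, v) \<in> commuting_rel G" by auto
  then have "(v, x) \<in> commuting_rel G" "(x, u) \<in> commuting_rel G ^^ n"
    using Suc.IH by (auto simp: commuting_rel_def)
  then show ?case by (rule relpow_Suc_I2)
qed simp

lemma (in wf_digraph) awalk_cost_one: "awalk_cost (\<lambda>_. 1) w = real (length w)"
  by (induction w) (simp_all add: awalk_cost_def)

lemma graph_distance_le:
  assumes "(u, v) \<in> commuting_rel G ^^ n" "u \<in> pverts (commuting_graph G)"
  shows "graph_distance (commuting_graph G) u v \<le> real n"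
proof -
  interpret wf_digraph "commuting_graph G" by (rule wf_commuting_graph)
  obtain w where w: "awalk u w v" "length w \<le> n" using relpow_imp_awalk[OF assms] by blast
  have "graph_distance (commuting_graph G) u v \<le> real (length w)"
    using min_cost_le_walk_cost[OF w(1), of "\<lambda>_. 1"]
    by (simp add: graph_distance_def awalk_cost_one)
  also have "\<dots> \<le> real n" using w(2) by simp
  finally show ?thesis .
qed

lemma graph_distance_ge:
  assumes "(u, v) \<notin> commuting_rel G ^^ n" "u \<in> pverts (commuting_graph G)"
  shows "real (Suc n) \<le> graph_distance (commuting_graph G) u v"
proof -
  interpret wf_digraph "commuting_graph G" by (rule wf_commuting_graph)
  have "Suc n \<le> length w" if "awalk u w v" for w
    using commuting_rel_relpow_mono[OF awalk_imp_relpow[OF that], of n] assms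
    by (fastforce simp: commuting_graph_def)
  then have "ereal (real (Suc n)) \<le> ereal (real (length w))" if "awalk u w v" for w
    using that by (simp del: of_nat_Suc)
  then show ?thesis
    unfolding graph_distance_def \<mu>_def by (intro INF_greatest) (simp add: awalk_cost_one del: of_nat_Suc)
qed

section \<open>Facts about the prime field and 2 x 2 matrices\<close>

lemma group_GL: "group (GL :: ('a::field ^ 'n ^ 'n) monoid)"
proof (rule groupI)
  fix A :: "'a::field ^ 'n ^ 'n" assume "A \<in> carrier GL"
  then show "\<exists>B\<in>carrier GL. B \<otimes>\<^bsub>GL\<^esub> A = \<one>\<^bsub>GL\<^esub>"
    by (auto simp: GL_def invertible_def)
next
  show "\<one>\<^bsub>GL\<^esub> \<in> carrier (GL :: ('a ^ 'n ^ 'n) monoid)"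
    by (auto simp: GL_def invertible_def intro!: exI[of _ "mat 1"])
qed (auto simp: GL_def invertible_mult matrix_mul_assoc)

text \<open>An element of order 3 is a root of X^3 - 1 = (X - 1)(X^2 + X + 1) other than 1.\<close>

lemma ord_3_imp_root:
  fixes \<alpha> :: "'p::prime_card mod_ring"
  defines "G \<equiv> Multiplicative_Group.mult_of (ring_of_type_algebra :: 'p mod_ring ring)"
  assumes a: "\<alpha> \<in> carrier G" "group.ord G \<alpha> = 3"
  shows "\<alpha>\<^sup>2 + \<alpha> + 1 = 0"
proof -
  interpret field "ring_of_type_algebra :: 'p mod_ring ring" by (rule field_from_type_algebra)
  interpret G: group G unfolding G_def by (rule field_mult_group)
  have pow: "x [^]\<^bsub>G\<^esub> n = x ^ n" for x and n :: nat
    by (induction n) (simp_all add: G_def nat_pow_mult_of ring_of_type_algebra_def)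
  have "\<alpha> ^ 3 = 1"
    using G.pow_ord_eq_1[OF a(1)] unfolding a(2) pow by (simp add: G_def ring_of_type_algebra_def)
  have "\<alpha> \<noteq> 1"
    using G.ord_eq_1[OF a(1)] unfolding a(2) by (simp add: G_def ring_of_type_algebra_def)
  have "(\<alpha> - 1) * (\<alpha>\<^sup>2 + \<alpha> + 1) = \<alpha> ^ 3 - 1" by (simp add: algebra_simps power2_eq_square power3_eq_cube)
  then show ?thesis using \<open>\<alpha> ^ 3 = 1\<close> \<open>\<alpha> \<noteq> 1\<close> by simp
qed

text \<open>Residue 1 modulo 3 excludes the primes 2 and 3, and no prime other than p vanishes
  modulo p.\<close>

lemma two_three_neq_0_mod_ring:
  fixes n :: int
  assumes "int CARD('p::prime_card) = 3 * n + 1"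
  shows "(2::'p mod_ring) \<noteq> 0" "(3::'p mod_ring) \<noteq> 0"
proof -
  have p: "prime CARD('p)" by (rule prime_card)
  have *: "of_nat k \<noteq> (0::'p mod_ring)" if "prime k" "k \<noteq> CARD('p)" for k
    using that p of_nat_0_mod_ring_dvd[of k, where ?'a='p] primes_dvd_imp_eq by blast
  have "CARD('p) \<noteq> 2" "CARD('p) \<noteq> 3" using assms by presburger+
  then show "(2::'p mod_ring) \<noteq> 0" "(3::'p mod_ring) \<noteq> 0" using *[of 2] *[of 3] by simp_all
qed

abbreviation mat2 :: "'a::zero \<Rightarrow> 'a \<Rightarrow> 'a \<Rightarrow> 'a \<Rightarrow> 'a ^ 2 ^ 2" where
  "mat2 a b c d \<equiv> vector [vector [a, b], vector [c, d]]"

lemma mat2_mult: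
  "mat2 a b c d ** mat2 a' b' c' d' =
   mat2 (a * a' + b * c') (a * b' + b * d') (c * a' + d * c') (c * b' + d * (d'::'a::semiring_1))"
  by (simp add: vec_eq_iff forall_2 matrix_matrix_mult_def sum_2)

lemma mat2_eq_iff: "mat2 a b c d = mat2 a' b' c' d' \<longleftrightarrow> a = a' \<and> b = b' \<and> c = c' \<and> d = d'"
  by (auto simp: vec_eq_iff forall_2)

lemma mat_1_eq_mat2: "mat 1 = mat2 1 0 0 (1::'a::semiring_1)"
  by (simp add: vec_eq_iff forall_2 mat_def)

lemma vector_mult_mat2:
  "vector [x, y] v* mat2 a b c d = vector [x * a + y * c, x * b + y * (d::'a::comm_semiring_1)]"
  by (simp add: vec_eq_iff forall_2 vector_matrix_mult_def sum_2 mult.commute)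

lemma vector2_eq_iff: "vector [x, y] = (vector [x', y'] :: 'a::zero ^ 2) \<longleftrightarrow> x = x' \<and> y = y'"
  by (auto simp: vec_eq_iff forall_2)

section \<open>Finite fields with a primitive cube root of unity: Eisenstein arithmetic\<close>

locale cube_root =
  fixes \<alpha> :: "'a::{field, finite}"
  assumes cube_root: "\<alpha>\<^sup>2 + \<alpha> + 1 = 0" and two_neq_0: "(2::'a) \<noteq> 0" and three_neq_0: "(3::'a) \<noteq> 0"
begin

text \<open>All matrix computations in \<open>groupS \<alpha>\<close> take place over the Eisenstein integers \<open>u + v \<alpha>\<close>; such an
  element is nonzero in the field as soon as its norm \<open>u\<^sup>2 - u v + v\<^sup>2\<close> is a product of powers of
  \<open>2\<close> and \<open>3\<close>.\<close>

definition eis :: "int \<Rightarrow> int \<Rightarrow> 'a" where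
  "eis u v = of_int u + of_int v * \<alpha>"

lemma eis_add: "eis u v + eis u' v' = eis (u + u') (v + v')"
  by (simp add: eis_def algebra_simps)

lemma eis_mult: "eis u v * eis u' v' = eis (u * u' - v * v') (u * v' + v * u' - v * v')"
proof -
  have "eis u v * eis u' v' - eis (u * u' - v * v') (u * v' + v * u' - v * v') = of_int (v * v') * (\<alpha>\<^sup>2 + \<alpha> + 1)"
    by (simp add: eis_def algebra_simps power2_eq_square)
  then show ?thesis by (simp add: cube_root)
qed

lemma eis_nonzero:
  assumes "u\<^sup>2 - u * v + v\<^sup>2 \<in> {1, 3, 4, 9, 12, 16}"
  shows "eis u v \<noteq> 0"
proof
  assume "eis u v = 0"
  \<comment> \<open>The second factor is the conjugate u + v \<alpha>^2 = (u - v) - v \<alpha>, so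
    the product is the norm.\<close>
  then have "eis u v * eis (u - v) (- v) = 0" by simp
  then have *: "of_int (u\<^sup>2 - u * v + v\<^sup>2) = (0::'a)"
    by (simp add: eis_mult) (simp add: eis_def algebra_simps power2_eq_square)
  have "(4::'a) = 2 * 2" "(9::'a) = 3 * 3" "(12::'a) = 2 * 2 * 3" "(16::'a) = 2 * 2 * 2 * 2" by simp_all
  then have "(4::'a) \<noteq> 0" "(9::'a) \<noteq> 0" "(12::'a) \<noteq> 0" "(16::'a) \<noteq> 0"
    using two_neq_0 three_neq_0 by (metis mult_eq_0_iff)+
  then have "of_int k \<noteq> (0::'a)" if "k \<in> {1, 3, 4, 9, 12, 16}" for k
    using that three_neq_0 by auto
  from this[OF assms] * show False by simp
qed

text \<open>Conditional rewrite rule: evaluating the norm of the difference on numerals refutes an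
  equation between matrix entries.\<close>

lemma eis_neq:
  assumes "(u - u')\<^sup>2 - (u - u') * (v - v') + (v - v')\<^sup>2 \<in> {1, 3, 4, 9, 12, 16}"
  shows "(eis u v = eis u' v') = False"
  using eis_nonzero[OF assms] by (simp add: eis_def algebra_simps)

section \<open>The 24 matrices of the complement\<close>

definition S24 :: "('a ^ 2 ^ 2) set" where
  "S24 =
    {mat2 (eis (-1) (-1)) (eis 0 1) (eis (-1) 0) (eis 0 0),
     mat2 (eis (-1) (-1)) (eis 0 1) (eis 0 0) (eis 1 0),
     mat2 (eis (-1) (-1)) (eis 0 1) (eis 0 1) (eis 1 1),
     mat2 (eis (-1) 0) (eis 0 0) (eis 0 0) (eis (-1) 0),
     mat2 (eis (-1) 0) (eis 0 0) (eis 0 1) (eis 1 1),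
     mat2 (eis (-1) 0) (eis 0 0) (eis 1 1) (eis 0 (-1)),
     mat2 (eis 0 (-1)) (eis (-1) (-1)) (eis (-1) (-1)) (eis 0 1),
     mat2 (eis 0 (-1)) (eis (-1) (-1)) (eis (-1) 0) (eis 0 0),
     mat2 (eis 0 (-1)) (eis (-1) (-1)) (eis 0 0) (eis (-1) 0),
     mat2 (eis 0 0) (eis (-1) 0) (eis (-1) (-1)) (eis 0 1),
     mat2 (eis 0 0) (eis (-1) 0) (eis 0 1) (eis 1 1),
     mat2 (eis 0 0) (eis (-1) 0) (eis 1 0) (eis 0 0),
     mat2 (eis 0 0) (eis 1 0) (eis (-1) 0) (eis 0 0),
     mat2 (eis 0 0) (eis 1 0) (eis 0 (-1)) (eis (-1) (-1)),
     mat2 (eis 0 0) (eis 1 0) (eis 1 1) (eis 0 (-1)),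
     mat2 (eis 0 1) (eis 1 1) (eis 0 0) (eis 1 0),
     mat2 (eis 0 1) (eis 1 1) (eis 1 0) (eis 0 0),
     mat2 (eis 0 1) (eis 1 1) (eis 1 1) (eis 0 (-1)),
     mat2 (eis 1 0) (eis 0 0) (eis (-1) (-1)) (eis 0 1),
     mat2 (eis 1 0) (eis 0 0) (eis 0 (-1)) (eis (-1) (-1)),
     mat2 (eis 1 0) (eis 0 0) (eis 0 0) (eis 1 0),
     mat2 (eis 1 1) (eis 0 (-1)) (eis 0 (-1)) (eis (-1) (-1)),
     mat2 (eis 1 1) (eis 0 (-1)) (eis 0 0) (eis (-1) 0),
     mat2 (eis 1 1) (eis 0 (-1)) (eis 1 0) (eis 0 0)}"

text \<open>The elements of \<open>S24\<close> other than the identity that fix a nonzero row vector, all of order \<open>3\<close>.\<close>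

definition F8 :: "('a ^ 2 ^ 2) set" where
  "F8 =
    {mat2 (eis (-1) (-1)) (eis 0 1) (eis 0 0) (eis 1 0),
     mat2 (eis 0 (-1)) (eis (-1) (-1)) (eis (-1) 0) (eis 0 0),
     mat2 (eis 0 0) (eis (-1) 0) (eis 0 1) (eis 1 1),
     mat2 (eis 0 0) (eis 1 0) (eis 1 1) (eis 0 (-1)),
     mat2 (eis 0 1) (eis 1 1) (eis 0 0) (eis 1 0),
     mat2 (eis 1 0) (eis 0 0) (eis (-1) (-1)) (eis 0 1),
     mat2 (eis 1 0) (eis 0 0) (eis 0 (-1)) (eis (-1) (-1)),
     mat2 (eis 1 1) (eis 0 (-1)) (eis 1 0) (eis 0 0)}"

lemma eis_mat2:
  "mat 1 = mat2 (eis 1 0) (eis 0 0) (eis 0 0) (eis 1 0)"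
  "matJ = mat2 (eis 0 0) (eis 1 0) (eis (-1) 0) (eis 0 0)"
  "matK \<alpha> = mat2 (eis 0 1) (eis 1 1) (eis 1 1) (eis 0 (-1))"
  "matL \<alpha> = mat2 (eis 1 1) (eis 0 (-1)) (eis 0 (-1)) (eis (-1) (-1))"
  "matZ \<alpha> = mat2 (eis (-1) (-1)) (eis 0 1) (eis 0 0) (eis 1 0)"
  by (simp_all add: matJ_def matK_def matL_def matZ_def mat_1_eq_mat2 eis_def mat2_eq_iff Let_def)

text \<open>Products keep their entries in the form \<open>eis _ _\<close>, which reduces matrix
  identities to integer numerals.\<close>

lemma eis_arith:
  "mat2 (eis a a') (eis b b') (eis c c') (eis d d') ** mat2 (eis e e') (eis f f') (eis g g') (eis h h') =
   mat2 (eis (a * e - a' * e' + (b * g - b' * g')) (a * e' + a' * e - a' * e' + (b * g' + b' * g - b' * g')))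
        (eis (a * f - a' * f' + (b * h - b' * h')) (a * f' + a' * f - a' * f' + (b * h' + b' * h - b' * h')))
        (eis (c * e - c' * e' + (d * g - d' * g')) (c * e' + c' * e - c' * e' + (d * g' + d' * g - d' * g')))
        (eis (c * f - c' * f' + (d * h - d' * h')) (c * f' + c' * f - c' * f' + (d * h' + d' * h - d' * h')))"
  by (simp only: mat2_mult eis_mult eis_add)

lemma generator_mult_S24:
  assumes "h \<in> {matJ, matK \<alpha>, matL \<alpha>, matZ \<alpha>}" "A \<in> S24"
  shows "h ** A \<in> S24"
proof -
  have "\<forall>h \<in> {matJ, matK \<alpha>, matL \<alpha>, matZ \<alpha>}. \<forall>A \<in> S24. h ** A \<in> S24"
    \<comment> \<open>Unrolls into 4 * 24 products, each of which is found in the list after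
      evaluation.\<close>
    unfolding S24_def ball_simps by (intro conjI TrueI; simp add: eis_mat2 eis_arith)
  with assms show ?thesis by blast
qed

lemma generator_inverse:
  assumes "h \<in> {matJ, matK \<alpha>, matL \<alpha>, matZ \<alpha>}"
  obtains B where "h ** B = mat 1" "B ** h = mat 1" "\<And>A. A \<in> S24 \<Longrightarrow> B ** A \<in> S24"
proof
  \<comment> \<open>the generators have order \<open>3\<close> or \<open>4\<close>, so \<open>h\<^sup>1\<^sup>1\<close> is the inverse in every case\<close>
  let ?B = "h ** (h ** (h ** (h ** (h ** (h ** (h ** (h ** (h ** (h ** h)))))))))"
  show "h ** ?B = mat 1" "?B ** h = mat 1"
    using assms by (auto simp: eis_mat2 eis_arith)
  show "?B ** A \<in> S24" if "A \<in> S24" for A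
    using that by (simp add: matrix_mul_assoc[symmetric] generator_mult_S24[OF assms])
qed

lemma generators_GL: "{matJ, matK \<alpha>, matL \<alpha>, matZ \<alpha>} \<subseteq> carrier GL"
proof
  fix h assume "h \<in> {matJ, matK \<alpha>, matL \<alpha>, matZ \<alpha>}"
  then obtain B where "h ** B = mat 1" "B ** h = mat 1" by (rule generator_inverse)
  then show "h \<in> carrier GL" by (auto simp: GL_def invertible_def)
qed

lemma subgroup_S: "subgroup (groupS \<alpha>) GL"
  unfolding groupS_def by (rule group.generate_is_subgroup[OF group_GL generators_GL])

lemma S_subset_S24: "groupS \<alpha> \<subseteq> S24"
proof
  interpret GL: group "GL :: ('a ^ 2 ^ 2) monoid" by (rule group_GL)
  have GL_simps: "A \<otimes>\<^bsub>GL\<^esub> B = A ** B" "\<one>\<^bsub>GL\<^esub> = (mat 1 :: 'a ^ 2 ^ 2)" for A B :: "'a ^ 2 ^ 2"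
    by (simp_all add: GL_def)
  fix B assume "B \<in> groupS \<alpha>"
  \<comment> \<open>Strengthened to left multiplication, so that the product case of the induction
    is composition; applied to the identity it yields \<open>B \<in> S24\<close>.\<close>
  then have "A \<in> S24 \<Longrightarrow> B ** A \<in> S24" for A
    unfolding groupS_def
  proof (induction arbitrary: A rule: generate.induct)
    case (inv h)
    obtain B where B: "h ** B = mat 1" "B ** h = mat 1" "\<And>A. A \<in> S24 \<Longrightarrow> B ** A \<in> S24"
      using generator_inverse[OF inv(1)] by blast
    then have "h \<in> carrier GL" "B \<in> carrier GL" by (auto simp: GL_def invertible_def)
    then have "inv\<^bsub>GL\<^esub> h = B" using B(2) by (intro GL.inv_equality) (simp_all add: GL_simps)
    then show ?case using B(3) inv(2) by simp
  qed (use generator_mult_S24 in \<open>simp_all add: GL_simps matrix_mul_assoc[symmetric]\<close>)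
  moreover have "mat 1 \<in> S24" by (simp add: S24_def eis_mat2)
  ultimately show "B \<in> S24" by force
qed

lemma
  shows S_one: "mat 1 \<in> groupS \<alpha>"
    and S_mult: "A \<in> groupS \<alpha> \<Longrightarrow> B \<in> groupS \<alpha> \<Longrightarrow> A ** B \<in> groupS \<alpha>"
    and S_right_inv: "A \<in> groupS \<alpha> \<Longrightarrow> A ** inv\<^bsub>GL\<^esub> A = mat 1"
    and S_left_inv: "A \<in> groupS \<alpha> \<Longrightarrow> inv\<^bsub>GL\<^esub> A ** A = mat 1"
    and S_inv_one: "inv\<^bsub>GL\<^esub> (mat 1 :: 'a ^ 2 ^ 2) = mat 1"
    and S_inv_mult: "A \<in> groupS \<alpha> \<Longrightarrow> B \<in> groupS \<alpha> \<Longrightarrow> inv\<^bsub>GL\<^esub> (A ** B) = inv\<^bsub>GL\<^esub> B ** inv\<^bsub>GL\<^esub> A"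
proof -
  interpret GL: group "GL :: ('a ^ 2 ^ 2) monoid" by (rule group_GL)
  interpret S: subgroup "groupS \<alpha>" GL by (rule subgroup_S)
  have GL_simps: "(**) = monoid.mult (GL :: ('a ^ 2 ^ 2) monoid)" "(mat 1 :: 'a ^ 2 ^ 2) = \<one>\<^bsub>GL\<^esub>"
    by (simp_all add: GL_def)
  show "mat 1 \<in> groupS \<alpha>"
    and "A \<in> groupS \<alpha> \<Longrightarrow> B \<in> groupS \<alpha> \<Longrightarrow> A ** B \<in> groupS \<alpha>"
    and "A \<in> groupS \<alpha> \<Longrightarrow> A ** inv\<^bsub>GL\<^esub> A = mat 1"
    and "A \<in> groupS \<alpha> \<Longrightarrow> inv\<^bsub>GL\<^esub> A ** A = mat 1"
    and "inv\<^bsub>GL\<^esub> (mat 1 :: 'a ^ 2 ^ 2) = mat 1"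
    and "A \<in> groupS \<alpha> \<Longrightarrow> B \<in> groupS \<alpha> \<Longrightarrow> inv\<^bsub>GL\<^esub> (A ** B) = inv\<^bsub>GL\<^esub> B ** inv\<^bsub>GL\<^esub> A"
    unfolding GL_simps by (simp_all add: GL.inv_mult_group)
qed

lemma
  shows J_in_S: "matJ \<in> groupS \<alpha>" and Z_in_S: "matZ \<alpha> \<in> groupS \<alpha>"
  by (simp_all add: groupS_def generate.incl)

abbreviation neg1 :: "'a ^ 2 ^ 2" where "neg1 \<equiv> mat2 (eis (-1) 0) (eis 0 0) (eis 0 0) (eis (-1) 0)"

lemma neg1_in_S: "neg1 \<in> groupS \<alpha>"
  using S_mult[OF J_in_S J_in_S] by (simp add: eis_mat2 eis_arith)

lemma vector_mult_neg1: "x v* neg1 = - x"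
  by (simp add: eis_def vec_eq_iff forall_2 vector_matrix_mult_def sum_2)

lemma mult_neg1: "A ** neg1 = neg1 ** A"
  by (simp add: eis_def vec_eq_iff forall_2 matrix_matrix_mult_def sum_2)

lemma double_eq_0: "x + x = 0 \<Longrightarrow> x = (0 :: 'a ^ 2)"
  using two_neq_0 by (simp add: vec_eq_iff flip: mult_2)

text \<open>Serves the lower bound: a matrix of order 3 that shifts a vector by a fixed
  \<open>x\<close> shifts it by 3x = 0 in three applications.\<close>

lemma add_triple_cancel: "y = y + x + x + x \<Longrightarrow> x = (0 :: 'a ^ 2)"
proof -
  assume "y = y + x + x + x"
  then have "x + x + x = 0" by (simp add: add.assoc)
  moreover have "3 * x $ i = (x + x + x) $ i" for i by simp
  ultimately have "3 * x $ i = 0" for i by simp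
  with three_neq_0 show "x = 0" by (simp add: vec_eq_iff)
qed

text \<open>The product of \<open>groupW \<alpha>\<close> involves inverses, while fixed vectors are
  computed for the matrices themselves.\<close>

lemma fixed_iff_inv:
  assumes "A \<in> groupS \<alpha>"
  shows "x v* inv\<^bsub>GL\<^esub> A = x \<longleftrightarrow> x v* A = x"
proof
  assume "x v* inv\<^bsub>GL\<^esub> A = x"
  then have "x v* A = x v* inv\<^bsub>GL\<^esub> A v* A" by simp
  then show "x v* A = x" by (simp only: vector_matrix_mul_assoc S_left_inv[OF assms] vector_matrix_mul_rid)
next
  assume "x v* A = x"
  then have "x v* inv\<^bsub>GL\<^esub> A = x v* A v* inv\<^bsub>GL\<^esub> A" by simp
  then show "x v* inv\<^bsub>GL\<^esub> A = x" by (simp only: vector_matrix_mul_assoc S_right_inv[OF assms] vector_matrix_mul_rid)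
qed

section \<open>Centre and commuting relation of the semidirect product\<close>

lemma carrier_W: "carrier (groupW \<alpha>) = UNIV \<times> groupS \<alpha>"
  by (simp add: groupW_def)

lemma mult_W: "(x, A) \<otimes>\<^bsub>groupW \<alpha>\<^esub> (y, B) = (x + y v* inv\<^bsub>GL\<^esub> A, A ** B)"
  by (simp add: groupW_def)

text \<open>Commuting with (0, -1) makes the translation part equal to its negative, hence zero;
  commuting with all translations then forces the linear part to fix every vector.\<close>

lemma center_W: "group_center (groupW \<alpha>) = {(0, mat 1)}"
proof (intro equalityI subsetI)
  fix g assume g: "g \<in> group_center (groupW \<alpha>)"
  obtain x A where [simp]: "g = (x, A)" by fastforce
  have A: "A \<in> groupS \<alpha>" and comm: "y + x v* inv\<^bsub>GL\<^esub> B = x + y v* inv\<^bsub>GL\<^esub> A" if "B \<in> groupS \<alpha>" for y B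
    using g that by (auto simp: group_center_def carrier_W mult_W)
  have "x v* inv\<^bsub>GL\<^esub> neg1 = x"
    using comm[OF neg1_in_S, of 0] by simp
  then have "x v* neg1 = x" by (simp add: fixed_iff_inv neg1_in_S)
  then have "x = - x" by (simp add: vector_mult_neg1)
  then have "x = 0" by (metis double_eq_0 add.right_inverse)
  have "y v* A = y" for y
    using comm[OF S_one, of y] A[OF S_one] \<open>x = 0\<close> by (simp add: S_inv_one flip: fixed_iff_inv)
  from this[of "vector [1, 0]"] this[of "vector [0, 1]"] have "A = mat 1"
    by (simp add: vec_eq_iff forall_2 vector_matrix_mult_def sum_2 mat_def)
  with \<open>x = 0\<close> show "g \<in> {(0, mat 1)}" by simp
qed (auto simp: group_center_def carrier_W mult_W S_one S_inv_one)

abbreviation "R \<equiv> commuting_rel (groupW \<alpha>)"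

lemma R_iff:
  "((x, A), (y, B)) \<in> R \<longleftrightarrow>
    A \<in> groupS \<alpha> \<and> B \<in> groupS \<alpha> \<and> (x, A) \<noteq> (0, mat 1) \<and> (y, B) \<noteq> (0, mat 1) \<and>
    A ** B = B ** A \<and> x + y v* inv\<^bsub>GL\<^esub> A = y + x v* inv\<^bsub>GL\<^esub> B"
  by (auto simp: commuting_rel_def center_W carrier_W mult_W)

text \<open>The conjugate of \<open>(0, A)\<close> by the translation \<open>(a, 1)\<close>.\<close>

definition conj_by :: "'a ^ 2 \<Rightarrow> 'a ^ 2 ^ 2 \<Rightarrow> ('a ^ 2) \<times> ('a ^ 2 ^ 2)" where
  "conj_by a A = (a - a v* inv\<^bsub>GL\<^esub> A, A)"

text \<open>Conjugation by a translation preserves commuting; in coordinates this comes down to the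
  inverses of \<open>A\<close> and \<open>B\<close> commuting.\<close>

lemma conj_by_adjacent:
  assumes "A \<in> groupS \<alpha>" "B \<in> groupS \<alpha>" "A \<noteq> mat 1" "B \<noteq> mat 1" "A ** B = B ** A"
  shows "(conj_by a A, conj_by a B) \<in> R"
proof -
  have "inv\<^bsub>GL\<^esub> A ** inv\<^bsub>GL\<^esub> B = inv\<^bsub>GL\<^esub> B ** inv\<^bsub>GL\<^esub> A"
    using assms by (simp flip: S_inv_mult)
  then show ?thesis
    using assms by (simp add: conj_by_def R_iff vector_matrix_mult_diff_distrib vector_matrix_mul_assoc)
qed

lemma fixed_adjacent:
  assumes "A \<in> groupS \<alpha>" "(y, A) \<noteq> (0, mat 1)" "u \<noteq> 0" "u v* A = u"
  shows "((y, A), (u, mat 1)) \<in> R"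
  using assms by (simp add: R_iff S_one S_inv_one fixed_iff_inv)

section \<open>Upper bound: three steps to one translation\<close>

definition e2 :: "'a ^ 2" where "e2 = vector [0, 1]"

lemma e2: "e2 \<noteq> 0" "e2 v* matZ \<alpha> = e2"
  by (simp_all add: e2_def vec_eq_iff forall_2 vector_matrix_mult_def sum_2 matZ_def Let_def)

lemma nontrivial: "neg1 \<noteq> mat 1" "matZ \<alpha> \<noteq> mat 1" "matJ \<noteq> (mat 1 :: 'a ^ 2 ^ 2)"
  by (simp_all add: eis_mat2 mat2_eq_iff eis_neq)

lemma relpow_3_e2:
  assumes "g \<in> carrier (groupW \<alpha>) - group_center (groupW \<alpha>)"
  shows "(g, (e2, mat 1)) \<in> R ^^ 3"
proof -
  obtain y A where g: "g = (y, A)" "A \<in> groupS \<alpha>" "(y, A) \<noteq> (0, mat 1)"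
    using assms by (auto simp: carrier_W center_W)
  show ?thesis
  proof (cases "\<exists>u. u \<noteq> 0 \<and> u v* A = u")
    case True
    then obtain u where "(g, (u, mat 1)) \<in> R" "u \<noteq> 0" using fixed_adjacent g by blast
    \<comment> \<open>Any two translations commute; the loop covers \<open>u = e2\<close>.\<close>
    moreover from this have "((u, mat 1), (e2, mat 1)) \<in> R"
      by (intro fixed_adjacent S_one) (simp_all add: e2)
    ultimately have "(g, (e2, mat 1)) \<in> R ^^ 2" by (auto simp: numeral_2_eq_2)
    then show ?thesis using commuting_rel_relpow_mono assms by fastforce
  next
    case False
    \<comment> \<open>Without nonzero fixed vectors 1 - A^-1 is injective, hence surjective on the
      finite plane, so \<open>y\<close> is the translation part of a conjugate of (0, A).\<close>
    have "inj (\<lambda>a. a - a v* inv\<^bsub>GL\<^esub> A)"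
    proof (rule injI)
      fix a b assume "a - a v* inv\<^bsub>GL\<^esub> A = b - b v* inv\<^bsub>GL\<^esub> A"
      then have "(a - b) v* inv\<^bsub>GL\<^esub> A = a - b"
        by (simp add: vector_matrix_mult_diff_distrib algebra_simps)
      then have "(a - b) v* A = a - b" by (simp only: fixed_iff_inv g(2))
      with False have "a - b = 0" by blast
      then show "a = b" by simp
    qed
    then have "surj (\<lambda>a. a - a v* inv\<^bsub>GL\<^esub> A)" by (rule finite_UNIV_inj_surj[OF finite])
    then obtain a where "y = a - a v* inv\<^bsub>GL\<^esub> A" by (rule surjE)
    then have a: "g = conj_by a A" by (simp add: g conj_by_def)
    have "e2 v* A \<noteq> e2" using False e2 by blast
    then have "A \<noteq> mat 1" by auto
    then have "(g, conj_by a neg1) \<in> R" unfolding a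
      by (intro conj_by_adjacent g neg1_in_S nontrivial mult_neg1)
    moreover have "(conj_by a neg1, conj_by a (matZ \<alpha>)) \<in> R"
      by (intro conj_by_adjacent Z_in_S neg1_in_S nontrivial mult_neg1[symmetric])
    moreover have "(conj_by a (matZ \<alpha>), (e2, mat 1)) \<in> R"
      unfolding conj_by_def by (rule fixed_adjacent) (simp_all add: e2 Z_in_S nontrivial)
    ultimately show ?thesis by (auto simp: numeral_3_eq_3)
  qed
qed

section \<open>Lower bound: fixed vectors and centralizers among the 24 matrices\<close>

text \<open>For A with rows (a, b) and (c, d): multiply (x, y)(A - 1) = 0 by the adjugate of A -
  1.\<close>

lemma cramer_2:
  fixes x y a b c d :: "'b::comm_ring_1"
  assumes "x * a + y * c = x" "x * b + y * d = y"
  shows "x * ((a - 1) * (d - 1) - b * c) = 0" and "y * ((a - 1) * (d - 1) - b * c) = 0"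
proof -
  have "x * ((a - 1) * (d - 1) - b * c) = (x * a + y * c - x) * (d - 1) - (x * b + y * d - y) * c"
    by (simp add: algebra_simps)
  then show "x * ((a - 1) * (d - 1) - b * c) = 0" by (simp only: assms diff_self mult_zero_left)
  have "y * ((a - 1) * (d - 1) - b * c) = (x * b + y * d - y) * (a - 1) - (x * a + y * c - x) * b"
    by (simp add: algebra_simps)
  then show "y * ((a - 1) * (d - 1) - b * c) = 0" by (simp only: assms diff_self mult_zero_left)
qed

text \<open>The premise is det(A - 1) \<noteq> 0, expanded in Eisenstein coordinates.\<close>

lemma fixed_vector_mat2:
  assumes "eis ((a - 1) * (d - 1) - a' * d' - (b * c - b' * c'))
               ((a - 1) * d' + a' * (d - 1) - a' * d' - (b * c' + b' * c - b' * c')) \<noteq> 0"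
  shows "w v* mat2 (eis a a') (eis b b') (eis c c') (eis d d') = w \<longleftrightarrow> w = 0"
proof
  assume fixed: "w v* mat2 (eis a a') (eis b b') (eis c c') (eis d d') = w"
  have minus_1: "eis u v - 1 = eis (u - 1) v" and minus: "eis u v - eis u' v' = eis (u - u') (v - v')" for u v u' v'
    by (simp_all add: eis_def algebra_simps)
  let ?det = "(eis a a' - 1) * (eis d d' - 1) - eis b b' * eis c c'"
  have "w $ 1 * eis a a' + w $ 2 * eis c c' = w $ 1" "w $ 1 * eis b b' + w $ 2 * eis d d' = w $ 2"
    using fixed by (simp_all add: vec_eq_iff forall_2 vector_matrix_mult_def sum_2 mult.commute)
  then have "w $ 1 * ?det = 0" "w $ 2 * ?det = 0"
    by (rule cramer_2)+
  moreover have "?det \<noteq> 0" using assms by (simp only: minus_1 minus eis_mult not_False_eq_True)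
  ultimately show "w = 0" by (simp add: vec_eq_iff forall_2)
qed simp

lemma fixed_vector_F8:
  assumes "A \<in> S24" "A \<noteq> mat 1" "w v* A = w" "w \<noteq> 0"
  shows "A \<in> F8"
proof -
  have "\<forall>A \<in> S24. A \<noteq> mat 1 \<longrightarrow> A \<notin> F8 \<longrightarrow> w v* A = w \<longrightarrow> w = 0"
    unfolding S24_def ball_simps
    by (intro conjI TrueI; simp add: F8_def eis_mat2 fixed_vector_mat2 eis_nonzero)
  with assms show ?thesis by blast
qed

definition ones :: "'a ^ 2" where "ones = vector [eis 1 0, eis 1 0]"

lemma ones_mult:
  "ones v* mat2 (eis a a') (eis b b') (eis c c') (eis d d') = vector [eis (a + c) (a' + c'), eis (b + d) (b' + d')]"
  by (simp add: ones_def vector_mult_mat2 eis_mult eis_add)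

lemma ones_not_fixed:
  assumes "A \<in> S24" "A \<noteq> mat 1"
  shows "ones v* A \<noteq> ones"
proof -
  have "\<forall>A \<in> S24. A \<noteq> mat 1 \<longrightarrow> ones v* A \<noteq> vector [eis 1 0, eis 1 0]"
    unfolding S24_def ball_simps
    by (intro conjI TrueI; simp add: eis_mat2 ones_mult vector2_eq_iff eis_neq)
  with assms show ?thesis by (simp add: ones_def)
qed

lemma F8_cube:
  assumes "A \<in> F8"
  shows "A ** A ** A = mat 1"
proof -
  have "\<forall>A \<in> F8. A ** A ** A = mat 1"
    unfolding F8_def ball_simps by (intro conjI TrueI; simp add: eis_mat2 eis_arith)
  with assms show ?thesis by blast
qed

text \<open>\<open>F8\<close> consists of the nontrivial elements of the four Sylow 3-subgroups;
  commuting elements of two different ones would generate a subgroup of order 9 in a group of order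
  24.\<close>

lemma F8_commute:
  assumes "A \<in> F8" "B \<in> F8" "A ** B = B ** A"
  shows "A = B \<or> A ** B = mat 1"
proof -
  have "\<forall>A \<in> F8. \<forall>B \<in> F8. A ** B = B ** A \<longrightarrow> A = B \<or> A ** B = mat 1"
    unfolding F8_def ball_simps
    by (intro conjI TrueI; simp add: eis_mat2 eis_arith mat2_eq_iff eis_neq)
  with assms show ?thesis by blast
qed

text \<open>No element of order 3 commutes with \<open>matJ\<close>. Hence a neighbour of (0, J)
  again has no nonzero fixed vector, and the walk can be followed one step further.\<close>

lemma commute_J_fixed_vector:
  assumes "A \<in> S24" "matJ ** A = A ** matJ" "A \<noteq> mat 1" "w v* A = w"
  shows "w = 0"
proof (rule ccontr)
  assume "w \<noteq> 0"
  with assms have "A \<in> F8" by (intro fixed_vector_F8)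
  moreover have "\<forall>A \<in> F8. matJ ** A \<noteq> A ** matJ"
    unfolding F8_def ball_simps
    by (intro conjI TrueI; simp add: eis_mat2 eis_arith mat2_eq_iff eis_neq)
  ultimately show False using assms(2) by blast
qed

section \<open>Lower bound: walks inside conjugates of the complement\<close>

text \<open>The deviation of the translation part of \<open>g\<close> from that of
  \<open>conj_by a B\<close> is fixed by \<open>A\<close>, hence zero: the centralizer stays in the
  same conjugate of the complement.\<close>

lemma conj_by_neighbour:
  assumes "(conj_by a A, g) \<in> R" "\<And>w. w v* A = w \<Longrightarrow> w = 0"
  obtains B where "g = conj_by a B" "B \<in> groupS \<alpha>" "B \<noteq> mat 1" "A ** B = B ** A"
proof -
  obtain y B where g: "g = (y, B)" by fastforce
  from assms(1) have R: "A \<in> groupS \<alpha>" "B \<in> groupS \<alpha>" "A ** B = B ** A" "(y, B) \<noteq> (0, mat 1)"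
    and eq: "a - a v* inv\<^bsub>GL\<^esub> A + y v* inv\<^bsub>GL\<^esub> A = y + (a - a v* inv\<^bsub>GL\<^esub> A) v* inv\<^bsub>GL\<^esub> B"
    by (simp_all add: g conj_by_def R_iff)
  have "inv\<^bsub>GL\<^esub> A ** inv\<^bsub>GL\<^esub> B = inv\<^bsub>GL\<^esub> B ** inv\<^bsub>GL\<^esub> A"
    using R by (simp flip: S_inv_mult)
  with eq have "(y - (a - a v* inv\<^bsub>GL\<^esub> B)) v* inv\<^bsub>GL\<^esub> A = y - (a - a v* inv\<^bsub>GL\<^esub> B)"
    by (simp add: vector_matrix_mult_diff_distrib vector_matrix_mul_assoc algebra_simps)
  then have "y - (a - a v* inv\<^bsub>GL\<^esub> B) = 0"
    using assms(2) R(1) by (simp only: fixed_iff_inv)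
  then have "y = a - a v* inv\<^bsub>GL\<^esub> B" by simp
  with R have "g = conj_by a B" "B \<noteq> mat 1" by (auto simp: g conj_by_def S_inv_one)
  with R that show thesis by blast
qed

lemma conj_by_J_relpow_2:
  assumes "(conj_by a matJ, g) \<in> R ^^ 2"
  obtains B where "g = conj_by a B" "B \<in> groupS \<alpha>" "B \<noteq> mat 1"
proof -
  from assms obtain h where h: "(conj_by a matJ, h) \<in> R" "(h, g) \<in> R"
    by (auto simp: numeral_2_eq_2)
  have "w = 0" if "w v* matJ = w" for w :: "'a ^ 2"
    using commute_J_fixed_vector[OF _ _ nontrivial(3) that] J_in_S S_subset_S24 by auto
  with h(1) obtain A where A: "h = conj_by a A" "A \<in> groupS \<alpha>" "A \<noteq> mat 1" "matJ ** A = A ** matJ"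
    by (rule conj_by_neighbour)
  have "w = 0" if "w v* A = w" for w
    using commute_J_fixed_vector[OF _ A(4,3) that] A(2) S_subset_S24 by auto
  with h(2) obtain B where "g = conj_by a B" "B \<in> groupS \<alpha>" "B \<noteq> mat 1"
    unfolding A(1) by (rule conj_by_neighbour)
  then show thesis by (rule that)
qed

lemma conj_by_ones_not_adjacent:
  assumes "A \<in> groupS \<alpha>" "B \<in> groupS \<alpha>" "A \<noteq> mat 1" "B \<noteq> mat 1"
  shows "(conj_by 0 A, conj_by ones B) \<notin> R"
proof
  let ?w = "ones - ones v* inv\<^bsub>GL\<^esub> B" and ?w' = "ones - ones v* inv\<^bsub>GL\<^esub> A"
  have S24: "A \<in> S24" "B \<in> S24" using assms S_subset_S24 by auto
  assume "(conj_by 0 A, conj_by ones B) \<in> R"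
  then have comm: "A ** B = B ** A" and w: "?w v* inv\<^bsub>GL\<^esub> A = ?w"
    by (simp_all add: conj_by_def R_iff)
  have "inv\<^bsub>GL\<^esub> A ** inv\<^bsub>GL\<^esub> B = inv\<^bsub>GL\<^esub> B ** inv\<^bsub>GL\<^esub> A"
    using assms comm by (simp flip: S_inv_mult)
  \<comment> \<open>Since the inverses commute, the condition that (1 - B^-1)(1 - A^-1) kills
    \<open>ones\<close> is symmetric in \<open>A\<close> and \<open>B\<close>.\<close>
  with w have w': "?w' v* inv\<^bsub>GL\<^esub> B = ?w'"
    by (simp add: vector_matrix_mult_diff_distrib vector_matrix_mul_assoc algebra_simps)
  have "?w \<noteq> 0" "?w' \<noteq> 0"
    using ones_not_fixed S24 assms by (auto simp: fixed_iff_inv dest: sym)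
  then have F8: "A \<in> F8" "B \<in> F8"
    using w w' S24 assms by (auto simp: fixed_iff_inv intro: fixed_vector_F8)
  have wA: "?w v* A = ?w" using w assms by (simp add: fixed_iff_inv)
  \<comment> \<open>\<open>B\<close> is \<open>A\<close> or its inverse, and both fix
    \<open>?w\<close>.\<close>
  have wB: "?w v* B = ?w"
    using F8_commute[OF F8 comm] wA by (metis vector_matrix_mul_assoc vector_matrix_mul_rid)
  have "ones v* inv\<^bsub>GL\<^esub> B v* B = ones"
    by (simp only: vector_matrix_mul_assoc S_left_inv assms vector_matrix_mul_rid)
  with wB have step: "ones v* B = ones + ?w"
    by (simp add: vector_matrix_mult_diff_distrib algebra_simps)
  \<comment> \<open>Each application of \<open>B\<close> adds \<open>?w\<close>, and three of them
    return to \<open>ones\<close>.\<close>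
  have "ones = ones v* B v* B v* B"
    using F8_cube[OF F8(2)] by (simp add: vector_matrix_mul_assoc)
  also have "\<dots> = ones + ?w + ?w + ?w"
    by (simp only: step vector_matrix_left_distrib wB)
  finally have "?w = 0" by (rule add_triple_cancel)
  with \<open>?w \<noteq> 0\<close> show False ..
qed

lemma not_relpow_5: "(conj_by 0 matJ, conj_by ones matJ) \<notin> R ^^ 5"
proof
  assume "(conj_by 0 matJ, conj_by ones matJ) \<in> R ^^ 5"
  \<comment> \<open>Two steps from either end stay in the respective conjugate of the complement, so
    the middle step would join the two conjugates.\<close>
  then have "(conj_by 0 matJ, conj_by ones matJ) \<in> R ^^ (2 + (1 + 2))" by simp
  then obtain g h where gh: "(conj_by 0 matJ, g) \<in> R ^^ 2" "(g, h) \<in> R" "(h, conj_by ones matJ) \<in> R ^^ 2"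
    unfolding relpow_add relpow_1 by blast
  obtain A where "g = conj_by 0 A" "A \<in> groupS \<alpha>" "A \<noteq> mat 1"
    using gh(1) by (rule conj_by_J_relpow_2)
  moreover obtain B where "h = conj_by ones B" "B \<in> groupS \<alpha>" "B \<noteq> mat 1"
    using commuting_rel_relpow_sym[OF gh(3)] by (rule conj_by_J_relpow_2)
  ultimately show False using gh(2) conj_by_ones_not_adjacent by blast
qed

section \<open>The diameter\<close>

lemma diameter_W: "graph_diameter (commuting_graph (groupW \<alpha>)) = 6"
proof (rule antisym)
  let ?V = "pverts (commuting_graph (groupW \<alpha>))"
  have "graph_distance (commuting_graph (groupW \<alpha>)) g h \<le> 6" if "g \<in> ?V" "h \<in> ?V" for g h
  proof -
    have "(g, (e2, mat 1)) \<in> R ^^ 3" "(h, (e2, mat 1)) \<in> R ^^ 3"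
      using that by (simp_all only: pverts_commuting_graph relpow_3_e2)
    then have "(g, (e2, mat 1)) \<in> R ^^ 3" "((e2, mat 1), h) \<in> R ^^ 3"
      using commuting_rel_relpow_sym by simp_all
    then have "(g, h) \<in> R ^^ (3 + 3)" unfolding relpow_add by blast
    from graph_distance_le[OF this that(1)] show ?thesis by simp
  qed
  then show "graph_diameter (commuting_graph (groupW \<alpha>)) \<le> 6"
    unfolding graph_diameter_def by (intro SUP_least) auto
  have V: "conj_by a matJ \<in> ?V" for a
    by (simp add: pverts_commuting_graph carrier_W center_W conj_by_def J_in_S nontrivial)
  \<comment> \<open>The fifth power covers all walks of length at most 5, so its failure gives
    distance at least \<open>Suc 5\<close>.\<close>
  have "6 \<le> graph_distance (commuting_graph (groupW \<alpha>)) (conj_by 0 matJ) (conj_by ones matJ)"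
    using graph_distance_ge[OF not_relpow_5 V] by simp
  also have "\<dots> \<le> graph_diameter (commuting_graph (groupW \<alpha>))"
    unfolding graph_diameter_def by (rule SUP_upper2[of "(conj_by 0 matJ, conj_by ones matJ)"]) (simp_all add: V)
  finally show "6 \<le> graph_diameter (commuting_graph (groupW \<alpha>))" .
qed

end

theorem theorem4p3:
  fixes p :: nat and n :: int and \<alpha> :: "'p::prime_card mod_ring"
  assumes "CARD('p) = p"
    and "prime p"
    and "int p = 3 * n + 1"
    and "\<alpha> \<in> carrier (Multiplicative_Group.mult_of ring_of_type_algebra)"
    and "group.ord (Multiplicative_Group.mult_of ring_of_type_algebra) \<alpha> = 3"
  shows "graph_diameter (commuting_graph (groupW \<alpha>)) = 6"
proof -
  interpret cube_root \<alpha>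
    using ord_3_imp_root[OF assms(4,5)] two_three_neq_0_mod_ring[of n, where ?'p = 'p]
      assms(1,3)
    by unfold_locales simp_all
  show ?thesis by (rule diameter_W)
qed

end
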